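(* For every real $r>0$, $$\int_0^\infty x\,e^{-x^2/\pi}\, \frac{\sinh x}{\cosh^2 x}\,dx=\frac r2\int_0^\infty \frac{e^{-r^2 x^2/\pi}}{\cosh (r x)}\,dx.$$
   Context: $\sinh$ and $\cosh$ are the hyperbolic functions. *)

theory Defs
  imports "HOL-Analysis.Analysis"
begin

end

theory Submission
  imports Defs "HOL-Probability.Characteristic_Functions" "HOL-Probability.Sinc_Integral"
    "HOL-Complex_Analysis.Residue_Theorem" "HOL-Real_Asymp.Real_Asymp"
begin

text \<open>
  Write \<open>u x = exp (- x\<^sup>2 / \<pi>)\<close>. Everything in sight is even, so one may integrate over the whole
  line, and the parameter \<open>r\<close> disappears by scaling. Integrating by parts with \<open>(1 / cosh)' = - sinh / cosh\<^sup>2\<close>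
  turns the left-hand side into the integral of \<open>(1 - 2 x\<^sup>2 / \<pi>) u x / cosh x\<close>, so the claim is that
  \<open>\<phi> x = (x\<^sup>2 - \<pi> / 4) u x\<close> is orthogonal to \<open>1 / cosh\<close>. For the cosine transform with kernel
  \<open>cos (2 x y / \<pi>)\<close>, the function \<open>1 / cosh\<close> has eigenvalue \<open>\<pi>\<close> (residue calculus on a rectangle of
  height \<open>\<pi>\<close>) while the second Hermite function \<open>\<phi>\<close> has eigenvalue \<open>- \<pi>\<close>; the transform is symmetric by
  Fubini, so eigenfunctions for different eigenvalues are orthogonal.
\<close>

section \<open>The Fourier transform of the hyperbolic secant\<close>

lemma cosh_ge_one_plus_half_square: "1 + x\<^sup>2 / 2 \<le> cosh (x::real)"
proof -
  have "\<bar>x / 2\<bar> \<le> \<bar>sinh (x / 2)\<bar>"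
    using real_le_abs_sinh[of "x / 2"] by (simp add: sinh_field_def exp_minus)
  hence "(x / 2)\<^sup>2 \<le> (sinh (x / 2))\<^sup>2"
    by (simp only: abs_le_square_iff)
  moreover have "cosh x = 1 + 2 * (sinh (x / 2))\<^sup>2"
    using cosh_double[of "x / 2"] by (simp add: cosh_square_eq)
  ultimately show ?thesis
    by (simp add: power_divide)
qed

lemma abs_divide_cosh_le: "\<bar>y / cosh x\<bar> \<le> \<bar>y\<bar>" for x y :: real
  using divide_left_mono[of 1 "cosh x" "\<bar>y\<bar>"] cosh_real_ge_1[of x] by simp

text \<open>The quadratic lower bound for cosh suffices: it allows comparison with a multiple of the
  Cauchy density.\<close>

lemma integrable_sech: "integrable lborel (\<lambda>x::real. 1 / cosh x)"
proof (rule Bochner_Integration.integrable_bound)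
  show "integrable lborel (\<lambda>x::real. 2 * inverse (1 + x\<^sup>2))"
    using integrable_inverse_1_plus_square by (simp add: einterval_eq_UNIV set_integrable_def)
  have "1 / cosh x \<le> 2 * inverse (1 + x\<^sup>2)" for x :: real
  proof -
    have "(1 + x\<^sup>2) / 2 \<le> cosh x"
      using cosh_ge_one_plus_half_square[of x] by simp
    hence "inverse (cosh x) \<le> inverse ((1 + x\<^sup>2) / 2)"
      by (intro le_imp_inverse_le) (auto intro: add_pos_nonneg)
    thus ?thesis by (simp add: field_simps)
  qed
  thus "AE x::real in lborel. norm (1 / cosh x) \<le> norm (2 * inverse (1 + x\<^sup>2))"
    by (auto intro!: AE_I2 order.trans[OF _ abs_ge_self])
qed (auto intro!: borel_measurable_continuous_onI continuous_intros)

text \<open>For \<open>z = x + i y\<close> the squared norm of \<open>cosh z\<close> is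
  \<open>(sinh x)^2 + (cos y)^2\<close>. The bound makes the vertical sides of the rectangle
  negligible and confines the zeros of cosh to the imaginary axis.\<close>

lemma norm_cosh_ge_abs_sinh_Re: "\<bar>sinh (Re z)\<bar> \<le> norm (cosh z)"
proof -
  have "(sinh (Re z))\<^sup>2 \<le> (norm (cosh z))\<^sup>2"
    using norm_cos_squared[of "\<i> * z"]
    by (simp add: cosh_conv_cos sinh_field_def exp_minus power_divide)
  thus ?thesis
    using abs_le_square_iff[of "sinh (Re z)" "norm (cosh z)"] by simp
qed

section \<open>Residue calculus on the rectangle of height pi\<close>

lemma contour_integral_linepath_translate:
  "contour_integral (linepath (a + c) (b + c)) f = contour_integral (linepath a b) (\<lambda>z. f (z + c))"
proof -
  have "linepath (a + c) (b + c) x = linepath a b x + c" for x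
    by (simp add: linepath_def algebra_simps)
  thus ?thesis
    by (simp add: contour_integral_integral)
qed

text \<open>The zeros of cosh are \<open>i (n + 1/2) pi\<close>. The bounds -1 and 4 are convenient
  numbers with \<open>- pi/2 < -1 < 0\<close> and \<open>pi < 4 < 3 pi/2\<close>: the open strip
  contains every closed rectangle of height pi on the real axis, but only the zero with
  \<open>n = -1\<close> in the parametrisation by \<open>i z\<close>.\<close>

lemma cosh_eq_0_in_strip:
  assumes "cosh z = 0" "-1 < Im z" "Im z < 4"
  shows "z = \<i> * (pi / 2)"
proof -
  obtain n :: int where n: "\<i> * z = complex_of_real (n * pi) + of_real pi / 2"
    using assms(1) by (auto simp: cosh_conv_cos cos_eq_0)
  have "Re (\<i> * z) = n * pi + pi / 2" "Im (\<i> * z) = 0"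
    unfolding n by auto
  hence z: "Re z = 0" "Im z = - (n + 1 / 2) * pi"
    by (auto simp: algebra_simps)
  have "n = -1"
  proof (rule ccontr)
    assume "n \<noteq> -1"
    then consider "n \<ge> 0" | "n \<le> -2" by linarith
    thus False
    proof cases
      case 1
      hence "(1 / 2) * pi \<le> (n + 1 / 2) * pi"
        by (intro mult_right_mono) auto
      thus False using assms z pi_gt3 by (simp add: algebra_simps)
    next
      case 2
      hence "real_of_int n \<le> -2" by linarith
      hence "(3 / 2) * pi \<le> (- (n + 1 / 2)) * pi"
        by (intro mult_right_mono) auto
      thus False using assms z pi_gt3 by (simp add: algebra_simps)
    qed
  qed
  thus ?thesis
    using z by (simp add: complex_eq_iff)
qed

text \<open>The only pole in the strip is \<open>p = i pi/2\<close>. It is simple because the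
  derivative of cosh there is \<open>sinh p = i\<close>, so the residue is
  \<open>exp (i w p) / i\<close>, and the factor \<open>2 pi i\<close> cancels the
  \<open>i\<close>.\<close>

lemma contour_integral_rectpath_sech:
  fixes w R :: real
  assumes "R > 0"
  shows "contour_integral (rectpath (- of_real R) (of_real R + \<i> * pi)) (\<lambda>z. exp (\<i> * w * z) / cosh z)
         = 2 * pi * exp (- pi * w / 2)"
proof -
  define S where "S = {z. -1 < Im z} \<inter> {z. Im z < 4}"
  define p where "p = \<i> * complex_of_real (pi / 2)"
  define g where "g = rectpath (- complex_of_real R) (of_real R + \<i> * pi)"
  have S: "open S" "convex S"
    unfolding S_def by (intro open_Int convex_Int open_halfspace_Im_gt open_halfspace_Im_lt
        convex_halfspace_Im_gt convex_halfspace_Im_lt)+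
  have pS: "p \<in> S"
    using pi_less_4 by (auto simp: p_def S_def intro: order.strict_trans2[of _ 0])
  have cosh_p: "cosh p = 0" and sinh_p: "sinh p = \<i>"
    by (simp_all add: p_def cosh_conv_cos sinh_conv_sin cos_of_real sin_of_real
        flip: mult.assoc of_real_divide)
  have cosh_holo: "(cosh :: complex \<Rightarrow> complex) holomorphic_on A" for A
    by (auto simp: holomorphic_on_def field_differentiable_def intro!: derivative_eq_intros)
  have nz: "cosh z \<noteq> 0" if "z \<in> S - {p}" for z
    using cosh_eq_0_in_strip[of z] that by (auto simp: S_def p_def)
  have "path_image g \<subseteq> S - {p}"
    using assms pi_less_4 pi_gt3 unfolding g_def
    by (subst path_image_rectpath) (auto simp: S_def p_def)
  moreover have "winding_number g z = 0" if "z \<notin> S" for z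
    unfolding g_def
    by (rule winding_number_rectpath_outside)
       (use assms that pi_less_4 in \<open>auto simp: in_cbox_complex_iff S_def\<close>)
  moreover have "(\<lambda>z. exp (\<i> * w * z) / cosh z) holomorphic_on S - {p}"
    using nz by (intro holomorphic_intros cosh_holo) auto
  ultimately have "contour_integral g (\<lambda>z. exp (\<i> * w * z) / cosh z)
      = 2 * pi * \<i> * (winding_number g p * residue (\<lambda>z. exp (\<i> * w * z) / cosh z) p)"
    using S Residue_theorem[of S "{p}" "\<lambda>z. exp (\<i> * w * z) / cosh z" g]
    by (simp add: g_def convex_connected)
  also have "winding_number g p = 1"
    unfolding g_def
    by (rule winding_number_rectpath) (use assms in \<open>auto simp: in_box_complex_iff p_def\<close>)
  also have "residue (\<lambda>z. exp (\<i> * w * z) / cosh z) p = exp (\<i> * w * p) / \<i>"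
  proof (rule residue_simple_pole_deriv[where s = S])
    show "(cosh has_field_derivative \<i>) (at p)"
      using sinh_p by (auto intro!: derivative_eq_intros)
  qed (use S pS in \<open>auto simp: convex_connected cosh_p intro!: holomorphic_intros cosh_holo\<close>)
  also have "exp (\<i> * w * p) = complex_of_real (exp (- pi * w / 2))"
    by (simp add: p_def mult_ac flip: exp_of_real)
  also have "2 * pi * \<i> * (1 * (complex_of_real y / \<i>)) = complex_of_real (2 * pi * y)" for y
    by (simp add: complex_eq_iff)
  finally show ?thesis
    unfolding g_def .
qed

text \<open>Shifting by \<open>i pi\<close> multiplies the integrand by
  \<open>- exp (- pi w)\<close>, so the two horizontal sides together give
  \<open>1 + exp (- pi w)\<close> times the integral over the real segment. The right-hand side
  bounds the two vertical sides and vanishes as \<open>R\<close> grows.\<close>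

lemma rectangle_integral_sech:
  fixes w R :: real and f :: "complex \<Rightarrow> complex"
  defines "f \<equiv> \<lambda>z. exp (\<i> * w * z) / cosh z"
  assumes "R > 0"
  shows "norm ((1 + exp (- pi * w)) * integral {-R..R} (\<lambda>x. f (of_real x)) - 2 * pi * exp (- pi * w / 2))
         \<le> 2 * pi * exp (pi * \<bar>w\<bar>) / sinh R"
proof -
  define a where "a = complex_of_real R"
  define c where "c = \<i> * complex_of_real pi"
  \<comment> \<open>Bound for the integrand on the vertical sides: there the numerator has norm
    \<open>exp (- w Im z)\<close> with \<open>Im z\<close> between 0 and pi, and the denominator has
    norm at least \<open>sinh R\<close>.\<close>
  define B where "B = exp (pi * \<bar>w\<bar>) / sinh R"
  have B: "B \<ge> 0" using assms by (simp add: B_def)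
  \<comment> \<open>The condition covers all four sides: vertical ones lie off the imaginary axis,
    horizontal ones at height 0 or pi, away from the pole at height \<open>pi/2\<close>.\<close>
  have cosh_nz: "cosh z \<noteq> 0" if "Re z \<noteq> 0 \<or> Im z \<in> {0, pi}" for z
  proof
    assume z: "cosh z = 0"
    hence "Re z = 0"
      using norm_cosh_ge_abs_sinh_Re[of z] by simp
    with that have "Im z \<in> {0, pi}" by simp
    hence "z = \<i> * (pi / 2)"
      using cosh_eq_0_in_strip[OF z] pi_less_4 pi_gt3 by auto
    hence "Im z = Im (\<i> * (pi / 2))" by (rule arg_cong)
    hence "Im z = pi / 2" by simp
    thus False using \<open>Im z \<in> {0, pi}\<close> by auto
  qed
  have horiz: "Im z = y" if "z \<in> closed_segment u v" "Im u = y" "Im v = y" for u v z :: complex and y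
    using that by (auto simp: closed_segment_def) (simp add: algebra_simps)
  have vert: "Re z = y" if "z \<in> closed_segment u v" "Re u = y" "Re v = y" for u v z :: complex and y
    using that by (auto simp: closed_segment_def) (simp add: algebra_simps)
  have vert_Im: "0 \<le> Im z \<and> Im z \<le> pi" if "z \<in> closed_segment u v"
      "{Im u, Im v} \<subseteq> {0..pi}" for u v z :: complex
    using that by (auto simp: closed_segment_def intro!: add_nonneg_nonneg mult_nonneg_nonneg convex_bound_le)
  have intble: "f contour_integrable_on linepath u v"
    if "\<And>z. z \<in> closed_segment u v \<Longrightarrow> cosh z \<noteq> 0" for u v
    unfolding f_def using that
    by (intro contour_integrable_continuous_linepath continuous_intros) auto
  have int_bottom: "f contour_integrable_on linepath (-a) a"
    by (rule intble) (use horiz[where y = 0] in \<open>force intro!: cosh_nz simp: a_def\<close>)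
  have int_right: "f contour_integrable_on linepath a (a + c)"
    by (rule intble, rule cosh_nz, rule disjI1)
       (use vert[where y = R] assms in \<open>force simp: a_def c_def\<close>)
  have int_top: "f contour_integrable_on linepath (a + c) (-a + c)"
    by (rule intble, rule cosh_nz, rule disjI2)
       (use horiz[where y = pi] in \<open>force simp: a_def c_def\<close>)
  have int_left: "f contour_integrable_on linepath (-a + c) (-a)"
    by (rule intble, rule cosh_nz, rule disjI1)
       (use vert[where y = "-R"] assms in \<open>force simp: a_def c_def\<close>)
  have bound: "norm (f z) \<le> B" if "\<bar>Re z\<bar> = R" "0 \<le> Im z \<and> Im z \<le> pi" for z
  proof -
    have "- (w * Im z) \<le> \<bar>w\<bar> * pi"
      using that by (intro abs_le_D2) (auto simp: abs_mult mult_left_mono)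
    hence "norm (exp (\<i> * w * z)) \<le> exp (pi * \<bar>w\<bar>)"
      by (simp add: mult_ac)
    moreover have "sinh R \<le> norm (cosh z)"
      using norm_cosh_ge_abs_sinh_Re[of z] that(1) by (metis sinh_real_abs)
    ultimately show ?thesis
      unfolding f_def B_def norm_divide using assms by (intro frac_le) auto
  qed
  have right: "norm (contour_integral (linepath a (a + c)) f) \<le> B * norm (a + c - a)"
    using vert[where u = a and v = "a + c" and y = R] vert_Im[where u = a and v = "a + c"] assms
    by (intro contour_integral_bound_linepath int_right B bound) (auto simp: a_def c_def)
  have left: "norm (contour_integral (linepath (-a + c) (-a)) f) \<le> B * norm (-a - (-a + c))"
    using vert[where u = "-a + c" and v = "-a" and y = "-R"] vert_Im[where u = "-a + c" and v = "-a"] assms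
    by (intro contour_integral_bound_linepath int_left B bound) (auto simp: a_def c_def)
  have period: "f (z + c) = - (exp (- pi * w) * f z)" for z
  proof -
    have "\<i> * w * (z + c) = complex_of_real (- pi * w) + \<i> * w * z"
      by (simp add: c_def algebra_simps)
    hence "exp (\<i> * w * (z + c)) = exp (- pi * w) * exp (\<i> * w * z)"
      by (simp only: exp_add exp_of_real)
    moreover have "cosh (z + c) = - cosh z"
      by (simp add: c_def cosh_conv_cos distrib_left cos_diff cos_of_real sin_of_real flip: mult.assoc)
    ultimately show ?thesis
      by (simp add: f_def)
  qed
  have bottom: "contour_integral (linepath (-a) a) f = integral {-R..R} (\<lambda>x. f (of_real x))"
    using assms by (subst contour_integral_linepath_Reals_eq) (auto simp: a_def)
  \<comment> \<open>The top side runs from right to left; this reversal cancels the minus sign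
    coming from \<open>period\<close>.\<close>
  have "contour_integral (linepath (a + c) (-a + c)) f
      = contour_integral (linepath a (-a)) (\<lambda>z. - exp (- pi * w) * f z)"
    by (simp only: contour_integral_linepath_translate period) simp
  also have "\<dots> = - exp (- pi * w) * contour_integral (linepath a (-a)) f"
    using contour_integrable_reversepath[OF valid_path_linepath int_bottom]
    by (subst contour_integral_lmul) simp_all
  also have "contour_integral (linepath a (-a)) f = - contour_integral (linepath (-a) a) f"
    using contour_integral_reversepath[OF valid_path_linepath, of "-a" a f] by simp
  finally have top: "contour_integral (linepath (a + c) (-a + c)) f
      = exp (- pi * w) * contour_integral (linepath (-a) a) f"
    by simp
  have "rectpath (-a) (a + c)
      = linepath (-a) a +++ linepath a (a + c) +++ linepath (a + c) (-a + c) +++ linepath (-a + c) (-a)"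
    by (simp add: rectpath_def Let_def a_def c_def Complex_eq)
  hence "contour_integral (rectpath (-a) (a + c)) f
     = contour_integral (linepath (-a) a) f + (contour_integral (linepath a (a + c)) f
       + (contour_integral (linepath (a + c) (-a + c)) f + contour_integral (linepath (-a + c) (-a)) f))"
    using int_bottom int_right int_top int_left by simp
  moreover have "contour_integral (rectpath (-a) (a + c)) f = 2 * pi * exp (- pi * w / 2)"
    unfolding f_def a_def c_def using contour_integral_rectpath_sech[OF assms(2)] by simp
  ultimately have "(1 + exp (- pi * w)) * integral {-R..R} (\<lambda>x. f (of_real x)) - 2 * pi * exp (- pi * w / 2)
     = - (contour_integral (linepath a (a + c)) f + contour_integral (linepath (-a + c) (-a)) f)"
    unfolding top bottom by (simp add: algebra_simps)
  also have "norm \<dots> \<le> B * pi + B * pi"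
    unfolding norm_minus_cancel using left right by (intro norm_triangle_mono) (auto simp: c_def norm_mult)
  finally show ?thesis by (simp add: B_def)
qed


text \<open>Letting the rectangle widen, the integral \<open>I\<close> of \<open>f\<close> over the
  real line satisfies \<open>(1 + exp (- pi w)) I = 2 pi exp (- pi w / 2)\<close>. At
  \<open>w = 2 y / pi\<close> the value is \<open>pi / cosh y\<close>, which is the eigenvalue pi of
  the cosine transform.\<close>

lemma integral_cos_sech:
  fixes w :: real
  shows "(\<integral>x. cos (w * x) / cosh x \<partial>lborel) = pi / cosh (pi * w / 2)"
proof -
  define f :: "complex \<Rightarrow> complex" where "f = (\<lambda>z. exp (\<i> * w * z) / cosh z)"
  have f_real: "f (of_real x) = cis (w * x) / of_real (cosh x)" for x :: real
    by (simp add: f_def cis_conv_exp cosh_field_def mult_ac flip: exp_of_real)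
  have f_int: "integrable lborel (\<lambda>x. f (of_real x))"
    by (rule Bochner_Integration.integrable_bound[OF integrable_sech])
       (auto simp: f_real norm_divide intro!: borel_measurable_continuous_onI continuous_intros)
  define I where "I = (\<integral>x. f (of_real x) \<partial>lborel)"
  have UN: "(\<Union>n. {- real n..real n}) = UNIV"
  proof (intro equalityI subsetI)
    fix x :: real
    obtain n where "\<bar>x\<bar> \<le> real n" using real_arch_simple by blast
    hence "x \<in> {- real n..real n}" by auto
    thus "x \<in> (\<Union>n. {- real n..real n})" by blast
  qed auto
  have "(\<lambda>n. LBINT x:{- real n..real n}. f (of_real x)) \<longlonglongrightarrow> (LBINT x:(\<Union>n. {- real n..real n}). f (of_real x))"
    by (rule set_integral_cont_up)
       (use f_int in \<open>auto simp: UN incseq_def set_integrable_def\<close>)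
  also have "(\<lambda>n. LBINT x:{- real n..real n}. f (of_real x)) = (\<lambda>n. integral {- real n..real n} (\<lambda>x. f (of_real x)))"
  proof
    fix n
    have "set_integrable lborel {- real n..real n} (\<lambda>x. f (of_real x))"
      by (rule set_integrable_subset[of lborel UNIV]) (use f_int in \<open>auto simp: set_integrable_def\<close>)
    thus "(LBINT x:{- real n..real n}. f (of_real x)) = integral {- real n..real n} (\<lambda>x. f (of_real x))"
      by (rule set_borel_integral_eq_integral(2))
  qed
  also have "(LBINT x:(\<Union>n. {- real n..real n}). f (of_real x)) = I"
    by (simp add: UN I_def set_lebesgue_integral_def)
  finally have "(\<lambda>n. integral {- real n..real n} (\<lambda>x. f (of_real x))) \<longlonglongrightarrow> I" .
  hence lim: "(\<lambda>n. (1 + exp (- pi * w)) * integral {- real n..real n} (\<lambda>x. f (of_real x))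
                 - 2 * pi * exp (- pi * w / 2))
          \<longlonglongrightarrow> (1 + exp (- pi * w)) * I - 2 * pi * exp (- pi * w / 2)"
    by (intro tendsto_intros)
  have "(\<lambda>n. 2 * pi * exp (pi * \<bar>w\<bar>) / sinh (real n)) \<longlonglongrightarrow> 0"
    by (intro tendsto_divide_0[OF tendsto_const] filterlim_at_top_imp_at_infinity
        filterlim_compose[OF sinh_real_at_top filterlim_real_sequentially])
  hence "(\<lambda>n. (1 + exp (- pi * w)) * integral {- real n..real n} (\<lambda>x. f (of_real x))
                 - 2 * pi * exp (- pi * w / 2)) \<longlonglongrightarrow> 0"
  proof (rule Lim_null_comparison[rotated])
    show "\<forall>\<^sub>F n in sequentially.
        norm ((1 + exp (- pi * w)) * integral {- real n..real n} (\<lambda>x. f (of_real x))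
                 - 2 * pi * exp (- pi * w / 2)) \<le> 2 * pi * exp (pi * \<bar>w\<bar>) / sinh (real n)"
      \<comment> \<open>The rectangle must have positive width, so \<open>n = 0\<close> is
        excluded.\<close>
      using eventually_gt_at_top[of 0]
    proof eventually_elim
      case (elim n)
      thus ?case
        unfolding f_def by (intro rectangle_integral_sech) simp
    qed
  qed
  with lim have "(1 + exp (- pi * w)) * I - 2 * pi * exp (- pi * w / 2) = 0"
    using LIMSEQ_unique by blast
  hence "Re ((1 + exp (- pi * w)) * I) = 2 * pi * exp (- pi * w / 2)"
    by simp
  \<comment> \<open>Extracting \<open>exp (- pi w / 2)\<close> symmetrises the factor, and the same
    exponential then cancels on the right.\<close>
  moreover have "1 + exp (- pi * w) = 2 * exp (- pi * w / 2) * cosh (pi * w / 2)"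
    by (simp add: cosh_field_def algebra_simps flip: exp_add)
  ultimately have "2 * exp (- pi * w / 2) * cosh (pi * w / 2) * Re I = 2 * pi * exp (- pi * w / 2)"
    by simp
  hence "Re I = pi / cosh (pi * w / 2)"
    by (simp add: field_simps)
  moreover have "Re I = (\<integral>x. cos (w * x) / cosh x \<partial>lborel)"
    using f_int unfolding I_def by (subst integral_Re [symmetric]) (auto simp: f_real)
  ultimately show ?thesis by simp
qed

section \<open>Gaussian integrals\<close>

text \<open>The variance \<open>pi/2\<close> is the one with \<open>2 \<sigma>^2 = pi\<close>; the
  normalising constant is then \<open>sqrt (pi^2) = pi\<close>. This gives access to the moments of
  the normal distribution.\<close>

lemma exp_square_eq_normal_density:
  "exp (- (x\<^sup>2 / pi)) = pi * normal_density 0 (sqrt (pi / 2)) x"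
proof -
  have "2 * pi * (sqrt (pi / 2))\<^sup>2 = pi\<^sup>2" "2 * (sqrt (pi / 2))\<^sup>2 = pi"
    by (simp_all add: power2_eq_square)
  thus ?thesis by (simp add: normal_density_def)
qed

text \<open>The majorant is a combination of the zeroth and second moment integrands of a centred
  normal density.\<close>

lemma integrable_gaussian_bound:
  fixes g :: "real \<Rightarrow> real"
  assumes "continuous_on UNIV g"
    and bound: "\<And>x. \<bar>g x\<bar> \<le> (a + b * x\<^sup>2) * exp (- (x\<^sup>2 / pi))"
  shows "integrable lborel g"
proof (rule Bochner_Integration.integrable_bound)
  have "integrable lborel (\<lambda>x::real. normal_density 0 (sqrt (pi / 2)) x * (x - 0) ^ k)" for k
    by (rule integrable_normal_moment) simp
  from this[of 0] this[of 2]
  have "integrable lborel (\<lambda>x::real. a * pi * normal_density 0 (sqrt (pi / 2)) x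
      + b * pi * (normal_density 0 (sqrt (pi / 2)) x * x\<^sup>2))"
    by (intro Bochner_Integration.integrable_add integrable_mult_right) auto
  also have "(\<lambda>x::real. a * pi * normal_density 0 (sqrt (pi / 2)) x
      + b * pi * (normal_density 0 (sqrt (pi / 2)) x * x\<^sup>2)) = (\<lambda>x. (a + b * x\<^sup>2) * exp (- (x\<^sup>2 / pi)))"
    by (simp add: exp_square_eq_normal_density algebra_simps)
  finally show "integrable lborel (\<lambda>x. (a + b * x\<^sup>2) * exp (- (x\<^sup>2 / pi)))" .
  show "AE x in lborel. norm (g x) \<le> norm ((a + b * x\<^sup>2) * exp (- (x\<^sup>2 / pi)))"
    using bound by (intro AE_I2) (metis abs_ge_self order.trans real_norm_def)
qed (use assms(1) in \<open>auto intro: borel_measurable_continuous_onI\<close>)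

text \<open>Integration by parts in disguise: Gaussian decay makes the antiderivative
  \<open>F\<close> vanish at both ends of the line, so there are no boundary terms.\<close>

lemma integral_derivative_gaussian_bound:
  fixes f F :: "real \<Rightarrow> real"
  assumes deriv: "\<And>x. (F has_real_derivative f x) (at x)"
    and cont: "continuous_on UNIV f" and int: "integrable lborel f"
    and bound: "\<And>x. \<bar>F x\<bar> \<le> (a + b * \<bar>x\<bar>) * exp (- (x\<^sup>2 / pi))"
  shows "(\<integral>x. f x \<partial>lborel) = 0"
proof -
  have top: "(F \<longlongrightarrow> 0) at_top"
  proof (rule Lim_null_comparison)
    show "((\<lambda>x::real. (a + b * \<bar>x\<bar>) * exp (- (x\<^sup>2 / pi))) \<longlongrightarrow> 0) at_top" by real_asymp
  qed (use bound in auto)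
  have bot: "(F \<longlongrightarrow> 0) at_bot"
  proof (rule Lim_null_comparison)
    show "((\<lambda>x::real. (a + b * \<bar>x\<bar>) * exp (- (x\<^sup>2 / pi))) \<longlongrightarrow> 0) at_bot" by real_asymp
  qed (use bound in auto)
  have "(LBINT x=-\<infinity>..\<infinity>. f x) = 0 - 0"
  proof (rule interval_integral_FTC_integrable)
    show "((F \<circ> real_of_ereal) \<longlongrightarrow> 0) (at_right (-\<infinity>))" "((F \<circ> real_of_ereal) \<longlongrightarrow> 0) (at_left \<infinity>)"
      using top bot by (simp_all add: ereal_tendsto_simps)
  qed (use deriv cont int in \<open>auto simp: has_real_derivative_iff_has_vector_derivative
         continuous_on_eq_continuous_at set_integrable_def einterval_eq_UNIV\<close>)
  thus ?thesis
    by (simp add: interval_lebesgue_integral_def set_lebesgue_integral_def einterval_eq_UNIV)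
qed

text \<open>Rescaling by the standard deviation \<open>s = sqrt (pi/2)\<close> turns the integral
  into the real part of the standard normal characteristic function at
  \<open>t = 2 x s / pi\<close>, and \<open>t^2 / 2 = x^2 / pi\<close>.\<close>

lemma integral_gaussian_cos:
  "(\<integral>y. exp (- (y\<^sup>2 / pi)) * cos (2 * x * y / pi) \<partial>lborel) = pi * exp (- (x\<^sup>2 / pi))"
proof -
  define s where "s = sqrt (pi / 2)"
  have s: "s > 0" "s\<^sup>2 = pi / 2" by (auto simp: s_def)
  define t where "t = 2 * x * s / pi"
  have t2: "t\<^sup>2 = 2 * x\<^sup>2 / pi"
    by (simp add: t_def power_mult_distrib power_divide s(2)) (simp add: power2_eq_square)
  have "integrable lborel (\<lambda>z. std_normal_density z *\<^sub>R iexp (t * z))"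
    by (rule Bochner_Integration.integrable_bound[OF integrable_std_normal_moment[of 0]])
       (auto intro!: borel_measurable_scaleR borel_measurable_continuous_onI continuous_intros)
  moreover have "complex_of_real (exp (- t\<^sup>2 / 2)) = (\<integral>z. std_normal_density z *\<^sub>R iexp (t * z) \<partial>lborel)"
    unfolding char_std_normal_distribution[THEN fun_cong, symmetric] char_def
    by (subst integral_density) (auto intro!: borel_measurable_continuous_onI continuous_intros)
  ultimately have "exp (- t\<^sup>2 / 2) = (\<integral>z. Re (std_normal_density z *\<^sub>R iexp (t * z)) \<partial>lborel)"
    by (metis Re_complex_of_real integral_Re)
  also have "\<dots> = (\<integral>z. std_normal_density z * cos (t * z) \<partial>lborel)"
    by (simp add: Re_exp)
  finally have *: "(\<integral>z. std_normal_density z * cos (t * z) \<partial>lborel) = exp (- t\<^sup>2 / 2)" ..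
  have "(\<integral>y. exp (- (y\<^sup>2 / pi)) * cos (2 * x * y / pi) \<partial>lborel)
      = s * (\<integral>z. exp (- ((s * z)\<^sup>2 / pi)) * cos (2 * x * (s * z) / pi) \<partial>lborel)"
    using s by (subst lborel_integral_real_affine[where c = s and t = 0]) auto
  also have "(\<lambda>z. exp (- ((s * z)\<^sup>2 / pi)) * cos (2 * x * (s * z) / pi))
      = (\<lambda>z. sqrt (2 * pi) * (std_normal_density z * cos (t * z)))"
    by (simp add: std_normal_density_def power_mult_distrib s(2) t_def mult_ac)
  also have "s * integral\<^sup>L lborel \<dots> = s * sqrt (2 * pi) * exp (- t\<^sup>2 / 2)"
    by (simp add: *)
  also have "s * sqrt (2 * pi) = pi"
    by (simp add: s_def flip: real_sqrt_mult)
  finally show ?thesis by (simp add: t2)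
qed

text \<open>Since \<open>f\<close> integrates to 0, the factor \<open>y^2\<close> may be replaced by
  \<open>pi/2 - x^2\<close> under the integral. Then \<open>y^2 - pi/4\<close> becomes the constant
  \<open>pi/4 - x^2\<close>, and the transform of the Gaussian finishes; the sign flip gives the
  eigenvalue \<open>- pi\<close>.\<close>

lemma integral_hermite_cos:
  fixes x :: real
  defines "\<phi> \<equiv> \<lambda>y. (y\<^sup>2 - pi / 4) * exp (- (y\<^sup>2 / pi))"
  shows "(\<integral>y. \<phi> y * cos (2 * x * y / pi) \<partial>lborel) = - pi * \<phi> x"
proof -
  define u where "u = (\<lambda>y::real. exp (- (y\<^sup>2 / pi)))"
  \<comment> \<open>An antiderivative of \<open>f\<close>: the two coefficients are chosen so that
    the sine terms of the derivative cancel.\<close>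
  define F where "F = (\<lambda>y. u y * (pi / 2 * x * sin (2 * x * y / pi) - pi / 2 * y * cos (2 * x * y / pi)))"
  define f where "f = (\<lambda>y. (y\<^sup>2 - pi / 2 + x\<^sup>2) * u y * cos (2 * x * y / pi))"
  have cos_int: "integrable lborel (\<lambda>y. u y * cos (2 * x * y / pi))"
    unfolding u_def
    by (rule integrable_gaussian_bound[where a = 1 and b = 0])
       (auto simp: abs_mult intro!: continuous_intros mult_left_le)
  have f_int: "integrable lborel f"
    unfolding f_def u_def
  proof (rule integrable_gaussian_bound[where a = "pi / 2 + x\<^sup>2" and b = 1])
    fix y :: real
    have "\<bar>y\<^sup>2 - pi / 2 + x\<^sup>2\<bar> \<le> pi / 2 + x\<^sup>2 + 1 * y\<^sup>2"
      using pi_ge_zero zero_le_power2[of x] zero_le_power2[of y] by linarith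
    thus "\<bar>(y\<^sup>2 - pi / 2 + x\<^sup>2) * exp (- (y\<^sup>2 / pi)) * cos (2 * x * y / pi)\<bar>
        \<le> (pi / 2 + x\<^sup>2 + 1 * y\<^sup>2) * exp (- (y\<^sup>2 / pi))"
      unfolding abs_mult by (intro order.trans[OF mult_left_le] mult_mono) auto
  qed (auto intro!: continuous_intros)
  have "(\<integral>y. f y \<partial>lborel) = 0"
  proof (rule integral_derivative_gaussian_bound[where F = F and a = "pi / 2 * \<bar>x\<bar>" and b = "pi / 2"])
    show "(F has_real_derivative f y) (at y)" for y
      unfolding F_def f_def u_def
      by (rule derivative_eq_intros refl | simp)+ (simp add: field_simps power2_eq_square)
    show "continuous_on UNIV f"
      unfolding f_def u_def by (intro continuous_intros) auto
    show "\<bar>F y\<bar> \<le> (pi / 2 * \<bar>x\<bar> + pi / 2 * \<bar>y\<bar>) * exp (- (y\<^sup>2 / pi))" for y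
    proof -
      have "\<bar>pi / 2 * x * sin (2 * x * y / pi) - pi / 2 * y * cos (2 * x * y / pi)\<bar>
          \<le> \<bar>pi / 2 * x * sin (2 * x * y / pi)\<bar> + \<bar>pi / 2 * y * cos (2 * x * y / pi)\<bar>"
        by (rule abs_triangle_ineq4)
      also have "\<dots> \<le> pi / 2 * \<bar>x\<bar> + pi / 2 * \<bar>y\<bar>"
        by (intro add_mono) (auto simp: abs_mult intro!: mult_left_le)
      finally show ?thesis
        by (simp add: F_def u_def abs_mult mult.commute mult_right_mono)
    qed
  qed (rule f_int)
  moreover have "\<phi> y * cos (2 * x * y / pi) = f y + (pi / 4 - x\<^sup>2) * (u y * cos (2 * x * y / pi))" for y
    by (simp add: \<phi>_def f_def u_def algebra_simps)
  ultimately have "(\<integral>y. \<phi> y * cos (2 * x * y / pi) \<partial>lborel)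
      = (pi / 4 - x\<^sup>2) * (\<integral>y. u y * cos (2 * x * y / pi) \<partial>lborel)"
    using f_int cos_int by simp
  also have "\<dots> = - pi * \<phi> x"
    unfolding u_def integral_gaussian_cos by (simp add: \<phi>_def algebra_simps)
  finally show ?thesis .
qed

section \<open>Orthogonality\<close>

text \<open>The double integral of \<open>K\<close> is evaluated in both orders. One inner integral
  is the transform of sech, the other that of \<open>\<phi>\<close>, so the integral in question
  equals its own negative after division by pi.\<close>

lemma integral_hermite_sech:
  "(\<integral>x. (x\<^sup>2 - pi / 4) * exp (- (x\<^sup>2 / pi)) / cosh x \<partial>lborel) = 0"
proof -
  define \<phi> where "\<phi> = (\<lambda>y::real. (y\<^sup>2 - pi / 4) * exp (- (y\<^sup>2 / pi)))"
  define K where "K = (\<lambda>x y. \<phi> y * cos (2 * x * y / pi) / cosh x)"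
  have \<phi>_int: "integrable lborel \<phi>"
    unfolding \<phi>_def
  proof (rule integrable_gaussian_bound[where a = "pi / 4" and b = 1])
    fix y :: real
    have "\<bar>y\<^sup>2 - pi / 4\<bar> \<le> pi / 4 + 1 * y\<^sup>2"
      using pi_ge_zero zero_le_power2[of y] by linarith
    thus "\<bar>(y\<^sup>2 - pi / 4) * exp (- (y\<^sup>2 / pi))\<bar> \<le> (pi / 4 + 1 * y\<^sup>2) * exp (- (y\<^sup>2 / pi))"
      by (simp add: abs_mult)
  qed (auto intro!: continuous_intros)
  have [measurable]: "\<phi> \<in> borel_measurable borel" "(cosh :: real \<Rightarrow> real) \<in> borel_measurable borel"
    by (auto simp: \<phi>_def intro!: borel_measurable_continuous_onI continuous_intros)
  \<comment> \<open>The cosine in \<open>K\<close> is at most 1 in absolute value, so this product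
    of integrable functions dominates \<open>K\<close> and justifies Fubini.\<close>
  have prod_int: "integrable (lborel \<Otimes>\<^sub>M lborel) (\<lambda>(x, y). 1 / cosh x * \<phi> y)"
  proof (rule lborel_pair.Fubini_integrable)
    show "integrable lborel (\<lambda>x. \<integral>y. norm (case (x, y) of (x, y) \<Rightarrow> 1 / cosh x * \<phi> y) \<partial>lborel)"
      using integrable_mult_right[OF integrable_sech, of "\<integral>y. \<bar>\<phi> y\<bar> \<partial>lborel"] by (simp add: abs_mult)
  qed (use \<phi>_int in auto)
  have "integrable (lborel \<Otimes>\<^sub>M lborel) (case_prod K)"
  proof (rule Bochner_Integration.integrable_bound[OF prod_int])
    have "\<bar>K x y\<bar> \<le> \<bar>1 / cosh x * \<phi> y\<bar>" for x y
    proof -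
      have "\<bar>K x y\<bar> = \<bar>1 / cosh x * \<phi> y\<bar> * \<bar>cos (2 * x * y / pi)\<bar>"
        by (simp add: K_def abs_mult)
      also have "\<dots> \<le> \<bar>1 / cosh x * \<phi> y\<bar>"
        by (rule mult_left_le) auto
      finally show ?thesis .
    qed
    thus "AE p in lborel \<Otimes>\<^sub>M lborel. norm (case_prod K p) \<le> norm (case p of (x, y) \<Rightarrow> 1 / cosh x * \<phi> y)"
      by (auto split: prod.split)
  qed (simp add: K_def)
  hence "(\<integral>y. (\<integral>x. K x y \<partial>lborel) \<partial>lborel) = (\<integral>x. (\<integral>y. K x y \<partial>lborel) \<partial>lborel)"
    by (rule lborel_pair.Fubini_integral)
  also have "(\<lambda>x. \<integral>y. K x y \<partial>lborel) = (\<lambda>x. - pi * (\<phi> x / cosh x))"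
    using integral_hermite_cos by (simp add: K_def \<phi>_def)
  also have "(\<lambda>y. \<integral>x. K x y \<partial>lborel) = (\<lambda>y. pi * (\<phi> y / cosh y))"
  proof
    fix y
    \<comment> \<open>Here the frequency is \<open>w = 2 y / pi\<close>, for which
      \<open>pi w / 2 = y\<close>.\<close>
    have "(\<integral>x. K x y \<partial>lborel) = \<phi> y * (\<integral>x. cos (2 * y / pi * x) / cosh x \<partial>lborel)"
      by (subst integral_mult_right_zero [symmetric]) (simp add: K_def mult_ac)
    thus "(\<integral>x. K x y \<partial>lborel) = pi * (\<phi> y / cosh y)"
      unfolding integral_cos_sech by simp
  qed
  finally have "pi * (\<integral>x. \<phi> x / cosh x \<partial>lborel) = - pi * (\<integral>x. \<phi> x / cosh x \<partial>lborel)"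
    by (simp only: integral_mult_right_zero)
  thus ?thesis by (simp add: \<phi>_def)
qed

section \<open>Passage to the half line and the final identity\<close>

lemma set_integral_even_function:
  fixes f :: "real \<Rightarrow> real"
  assumes int: "integrable lborel f" and even: "\<And>x. f (- x) = f x"
  shows "set_integrable lborel {0..} f" and "2 * (LBINT x:{0..}. f x) = (\<integral>x. f x \<partial>lborel)"
proof -
  show int': "set_integrable lborel {0..} f"
    by (rule set_integrable_subset[of lborel UNIV]) (use int in \<open>auto simp: set_integrable_def\<close>)
  have "has_bochner_integral lborel f (2 *\<^sub>R (LBINT x:{0..}. f x))"
    using int' even unfolding set_integrable_def set_lebesgue_integral_def
    by (intro has_bochner_integral_even_function has_bochner_integral_integrable)
  thus "2 * (LBINT x:{0..}. f x) = (\<integral>x. f x \<partial>lborel)"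
    using has_bochner_integral_integral_eq by fastforce
qed

theorem mainTheorem14:
  fixes r :: real
  assumes "r > 0"
  shows "set_integrable lborel {0..} (\<lambda>x::real. x * exp (- (x\<^sup>2 / pi)) * (sinh x / (cosh x)\<^sup>2)) \<and>
    set_integrable lborel {0..} (\<lambda>x::real. exp (- (r\<^sup>2 * x\<^sup>2 / pi)) / cosh (r * x)) \<and>
    (LBINT x:{0..}. x * exp (- (x\<^sup>2 / pi)) * (sinh x / (cosh x)\<^sup>2)) =
      r / 2 * (LBINT x:{0..}. exp (- (r\<^sup>2 * x\<^sup>2 / pi)) / cosh (r * x))"
proof -
  define u where "u = (\<lambda>y::real. exp (- (y\<^sup>2 / pi)))"
  define g where "g = (\<lambda>x. u x / cosh x)"
  define q where "q = (\<lambda>x. x\<^sup>2 * u x / cosh x)"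
  define k where "k = (\<lambda>x. x * u x * (sinh x / (cosh x)\<^sup>2))"
  \<comment> \<open>The right-hand integrand; substituting back to \<open>g\<close> produces the
    factor \<open>r\<close>.\<close>
  define G where "G = (\<lambda>x. g (r * x))"
  \<comment> \<open>The boundary term of the integration by parts. Its derivative has three terms,
    one per factor: \<open>g\<close>, then \<open>- 2 / pi * q\<close> from the Gaussian, then
    \<open>- k\<close> from \<open>1 / cosh\<close>.\<close>
  define F where "F = (\<lambda>x. x * u x / cosh x)"
  have g_int: "integrable lborel g"
    unfolding g_def u_def
    by (rule integrable_gaussian_bound[where a = 1 and b = 0])
       (intro continuous_intros order.trans[OF abs_divide_cosh_le]; simp)+
  have q_int: "integrable lborel q"
    unfolding q_def u_def
    by (rule integrable_gaussian_bound[where a = 0 and b = 1])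
       (intro continuous_intros order.trans[OF abs_divide_cosh_le]; simp)+
  have tanh_le: "\<bar>sinh x / (cosh x)\<^sup>2\<bar> \<le> 1" for x :: real
  proof -
    have "\<bar>sinh x\<bar> \<le> cosh x"
      using sinh_le_cosh_real[of "\<bar>x\<bar>"] by simp
    also have "\<dots> \<le> (cosh x)\<^sup>2"
      using cosh_real_ge_1[of x] by (simp add: power2_eq_square)
    finally show ?thesis by (simp add: divide_le_eq)
  qed
  have k_int: "integrable lborel k"
    unfolding k_def u_def
  proof (rule integrable_gaussian_bound[where a = 1 and b = 1])
    fix x :: real
    \<comment> \<open>Brings the linear factor into the form \<open>a + b x^2\<close> of the
      Gaussian majorant.\<close>
    have "0 \<le> (\<bar>x\<bar> - 1)\<^sup>2" by simp
    hence "\<bar>x\<bar> \<le> 1 + 1 * x\<^sup>2"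
      unfolding power2_diff by simp
    thus "\<bar>x * exp (- (x\<^sup>2 / pi)) * (sinh x / (cosh x)\<^sup>2)\<bar> \<le> (1 + 1 * x\<^sup>2) * exp (- (x\<^sup>2 / pi))"
      unfolding abs_mult[of _ "sinh x / _"]
      by (intro order.trans[OF mult_left_le[OF tanh_le]]) (auto simp: abs_mult)
  qed (auto intro!: continuous_intros)
  have G_int: "integrable lborel G"
    using lborel_integrable_real_affine[OF g_int, of r 0] assms by (simp add: G_def)
  have "(\<integral>x. g x - 2 / pi * q x - k x \<partial>lborel) = 0"
  proof (rule integral_derivative_gaussian_bound[where F = F and a = 0 and b = 1])
    show "(F has_real_derivative g x - 2 / pi * q x - k x) (at x)" for x
      unfolding F_def g_def q_def k_def u_def
      by (rule derivative_eq_intros refl | simp)+ (simp add: field_simps power2_eq_square)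
    show "continuous_on UNIV (\<lambda>x. g x - 2 / pi * q x - k x)"
      unfolding g_def q_def k_def u_def by (intro continuous_intros) auto
    show "\<bar>F x\<bar> \<le> (0 + 1 * \<bar>x\<bar>) * exp (- (x\<^sup>2 / pi))" for x
      unfolding F_def u_def by (rule order.trans[OF abs_divide_cosh_le]) (simp add: abs_mult)
  qed (use g_int q_int k_int in auto)
  moreover have "(\<integral>x. q x - pi / 4 * g x \<partial>lborel) = 0"
    using integral_hermite_sech by (simp add: q_def g_def u_def algebra_simps diff_divide_distrib)
  \<comment> \<open>Orthogonality makes the integral of \<open>q\<close> equal to
    \<open>pi/4\<close> times that of \<open>g\<close>, and
    \<open>1 - (2 / pi) (pi / 4) = 1/2\<close>.\<close>
  ultimately have "(\<integral>x. k x \<partial>lborel) = 1 / 2 * (\<integral>x. g x \<partial>lborel)"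
    using g_int q_int k_int by (simp add: field_simps)
  also have "(\<integral>x. g x \<partial>lborel) = r * (\<integral>x. G x \<partial>lborel)"
    using assms by (subst lborel_integral_real_affine[where c = r and t = 0]) (auto simp: G_def)
  finally have "(\<integral>x. k x \<partial>lborel) = r / 2 * (\<integral>x. G x \<partial>lborel)" by simp
  moreover have even: "k (- x) = k x" "G (- x) = G x" for x
    by (simp_all add: k_def G_def g_def u_def)
  moreover note set_integral_even_function(2)[OF k_int even(1)] set_integral_even_function(2)[OF G_int even(2)]
  ultimately have "2 * (LBINT x:{0..}. k x) = r / 2 * (2 * (LBINT x:{0..}. G x))"
    by simp
  hence "set_integrable lborel {0..} k \<and> set_integrable lborel {0..} G \<and>
      (LBINT x:{0..}. k x) = r / 2 * (LBINT x:{0..}. G x)"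
    using set_integral_even_function(1)[OF k_int even(1)] set_integral_even_function(1)[OF G_int even(2)]
    by simp
  thus ?thesis
    by (simp add: k_def G_def g_def u_def power_mult_distrib)
qed

end
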